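(* Let $(Y,\tau)$ be a topological space and $(Z,\mathcal{U})$ a uniform space. A topology $\mathfrak{T}$ on $EC(Y,Z)$ is admissible if and only if its dual topology $\mathbb{T}(\mathfrak{T})$ on $\mathcal{O}_Z(Y)$ is admissible.
   Context: Uniform spaces $(Z,\mathcal{U})$ are given in the usual sense by a family $\mathcal{U}$ of entourages on a non-empty set $Z$. For $U\in\mathcal{U}$ and $z\in Z$, $U[z]=\{w\in Z : (z,w)\in U\}$. Equi-continuity: a function $f:(X,\tau)\to(Z,\mathcal{U})$ from a topological space to a uniform space is equi-continuous at $x\in X$ if for each $U\in\mathcal{U}$ there is an open neighbourhood $V$ of $x$ with $f(V)\subseteq U[f(x)]$; it is equi-continuous if this holds at all $x\in X$. $EC(Y,Z)$ is the set of all equi-continuous functions from $Y$ to $Z$. The set $\mathcal{O}_Z(Y)$: for each $U\in\mathcal{U}$, $f\in EC(Y,Z)$, $y\in Y$ fix an open neighbourhood of $y$ in $Y$, denoted $U(f,y)$, with $f(U(f,y))\subseteq U[f(y)]$ (it exists by equi-continuity). Put $\mathcal{O}_Z(Y)=\{U(f,y) : U\in\mathcal{U}, f\in EC(Y,Z), y\in Y\}$. Dual topology: for $\mathcal{H}\subseteq EC(Y,Z)$ and $U\in\mathcal{U}$ let $(\mathcal{H},U)=\{U(f,y) : f\in\mathcal{H}, y\in Y\}\subseteq\mathcal{O}_Z(Y)$. For a topology $\mathfrak{T}$ on $EC(Y,Z)$, its dual $\mathbb{T}(\mathfrak{T})$ is the topology on $\mathcal{O}_Z(Y)$ generated by the subbasis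 $\{(\mathcal{H},U) : \mathcal{H}\in\mathfrak{T}, U\in\mathcal{U}\}$. Associated maps: for a topological space $X$, maps $g:X\times Y\to Z$ and $g^*:X\to EC(Y,Z)$ are associated if $g^*(x)(y)=g(x,y)$ for all $x\in X$, $y\in Y$. For associated $g,g^*$ define the multifunction $\overline{g}:X\times\mathcal{U}\to\mathcal{O}_Z(Y)$ by $\overline{g}(x,U)=\{U(g^*(x),y) : y\in Y\}$. Upper semi continuity: a multifunction $F:X\to W$ between topological spaces is upper semi continuous if for each $x\in X$ and each open $V\subseteq W$ with $F(x)\subseteq V$ there is an open $O\ni x$ with $F(x')\subseteq V$ for all $x'\in O$. A multifunction $M:X\times\mathcal{U}\to\mathcal{O}_Z(Y)$ is upper semi continuous with respect to the first variable if for every fixed $U\in\mathcal{U}$ the multifunction $M_U:X\to\mathcal{O}_Z(Y)$, $M_U(x)=M(x,U)$, is upper semi continuous. Admissible: a topology $\mathfrak{T}$ on $EC(Y,Z)$ is admissible if the evaluation map $e:EC(Y,Z)\times Y\to Z$, $e(f,y)=f(y)$, is equi-continuous (with the product topology on $EC(Y,Z)\times Y$). A topology $\mathbb{T}$ on $\mathcal{O}_Z(Y)$ is admissible if for each topological space $(X,\mu)$ and every map $g^*:X\to EC(Y,Z)$, upper semi continuity with respect to the first variable of $\overline{g}:X\times\mathcal{U}\to(\mathcal{O}_Z(Y),\mathbb{T})$ implies equi-continuity of the associated map $g:X\times Y\to Z$.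
   Formalization: O_Z(Y) is taken as the family of U(f,y) indexed by (U,f,y), not the bare set of values (false for Y a point, Z two-point discrete, T discrete); test spaces X have points in the disjoint union of the functions Y→Z and an arbitrary set, which covers all spaces up to homeomorphism. *)

theory Defs
  imports "HOL-Analysis.Analysis"
begin

definition entourages :: "('z::uniform_space \<times> 'z) set set" where
  "entourages = {U. eventually (\<lambda>p. p \<in> U) uniformity}"

text \<open>
  Topological spaces are given by \<^typ>\<open>'a topology\<close>, the uniform space \<open>Z\<close> by a type of class
  \<^class>\<open>uniform_space\<close>. Note that \<open>U[z]\<close> is \<open>U `` {z}\<close>.
\<close>

definition equi_continuous_at :: "'a topology \<Rightarrow> ('a \<Rightarrow> 'z::uniform_space) \<Rightarrow> 'a \<Rightarrow> bool" where
  "equi_continuous_at X f x \<longleftrightarrow>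
     (\<forall>U\<in>entourages. \<exists>V. openin X V \<and> x \<in> V \<and> f ` V \<subseteq> U `` {f x})"

definition equi_continuous :: "'a topology \<Rightarrow> ('a \<Rightarrow> 'z::uniform_space) \<Rightarrow> bool" where
  "equi_continuous X f \<longleftrightarrow> (\<forall>x\<in>topspace X. equi_continuous_at X f x)"

text \<open>
  Functions with domain \<open>topspace Y\<close> are represented by their extensional representatives, so that
  equality in \<open>EC Y\<close> is equality of functions on \<open>topspace Y\<close>.
\<close>

definition EC :: "'y topology \<Rightarrow> ('y \<Rightarrow> 'z::uniform_space) set" where
  "EC Y = {f \<in> extensional (topspace Y). equi_continuous Y f}"

definition nbhd_choice ::
  "'y topology \<Rightarrow> (('z \<times> 'z) set \<Rightarrow> ('y \<Rightarrow> 'z::uniform_space) \<Rightarrow> 'y \<Rightarrow> 'y set) \<Rightarrow> bool" where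
  "nbhd_choice Y N \<longleftrightarrow>
     (\<forall>U\<in>entourages. \<forall>f\<in>EC Y. \<forall>y\<in>topspace Y.
        openin Y (N U f y) \<and> y \<in> N U f y \<and> f ` N U f y \<subseteq> U `` {f y})"

text \<open>
  The collection of the neighbourhoods \<open>U(f,y)\<close> is a family indexed by the triples \<open>(U,f,y)\<close>, not
  its mere set of values: different triples give different members, even if the chosen open sets
  coincide. A member is therefore a pair of an index and the neighbourhood chosen for it. Without
  the indices the theorem fails: for a one-point \<open>Y\<close>, all \<open>U(f,y)\<close> are equal as sets, so
  every topology on the set of values is trivial and every multifunction into it is upper semi
  continuous.
\<close>

type_synonym ('y, 'z) nbhd = "(('z \<times> 'z) set \<times> ('y \<Rightarrow> 'z) \<times> 'y) \<times> 'y set"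

definition nbhd ::
  "(('z \<times> 'z) set \<Rightarrow> ('y \<Rightarrow> 'z) \<Rightarrow> 'y \<Rightarrow> 'y set)
     \<Rightarrow> ('z \<times> 'z) set \<Rightarrow> ('y \<Rightarrow> 'z) \<Rightarrow> 'y \<Rightarrow> ('y, 'z) nbhd" where
  "nbhd N U f y = ((U, f, y), N U f y)"

definition nbhd_family ::
  "'y topology \<Rightarrow> (('z \<times> 'z) set \<Rightarrow> ('y \<Rightarrow> 'z::uniform_space) \<Rightarrow> 'y \<Rightarrow> 'y set)
     \<Rightarrow> ('y, 'z) nbhd set" where
  "nbhd_family Y N = {nbhd N U f y | U f y. U \<in> entourages \<and> f \<in> EC Y \<and> y \<in> topspace Y}"

definition dual_set ::
  "'y topology \<Rightarrow> (('z \<times> 'z) set \<Rightarrow> ('y \<Rightarrow> 'z) \<Rightarrow> 'y \<Rightarrow> 'y set)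
     \<Rightarrow> ('y \<Rightarrow> 'z) set \<Rightarrow> ('z \<times> 'z) set \<Rightarrow> ('y, 'z) nbhd set" where
  "dual_set Y N H U = {nbhd N U f y | f y. f \<in> H \<and> y \<in> topspace Y}"

definition dual_topology ::
  "'y topology \<Rightarrow> (('z \<times> 'z) set \<Rightarrow> ('y \<Rightarrow> 'z::uniform_space) \<Rightarrow> 'y \<Rightarrow> 'y set)
     \<Rightarrow> ('y \<Rightarrow> 'z) topology \<Rightarrow> ('y, 'z) nbhd topology" where
  "dual_topology Y N T =
     topology_generated_by {dual_set Y N H U | H U. openin T H \<and> U \<in> entourages}"

lemma topspace_dual_topology:
  assumes "topspace T = EC Y"
  shows "topspace (dual_topology Y N T) = nbhd_family Y N"
proof -
  have EC: "openin T (EC Y)" by (metis assms openin_topspace)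
  have sub: "H \<subseteq> EC Y" if "openin T H" for H
    using openin_subset[OF that] by (simp add: assms)
  have "topspace (dual_topology Y N T) = \<Union>{dual_set Y N H U | H U. openin T H \<and> U \<in> entourages}"
    by (simp add: dual_topology_def)
  also have "\<dots> = nbhd_family Y N"
    unfolding nbhd_family_def dual_set_def using EC sub by blast
  finally show ?thesis .
qed

definition associated ::
  "'x topology \<Rightarrow> 'y topology \<Rightarrow> ('x \<times> 'y \<Rightarrow> 'z) \<Rightarrow> ('x \<Rightarrow> 'y \<Rightarrow> 'z) \<Rightarrow> bool" where
  "associated X Y g gs \<longleftrightarrow> (\<forall>x\<in>topspace X. \<forall>y\<in>topspace Y. gs x y = g (x, y))"

definition bar_map ::
  "'y topology \<Rightarrow> (('z \<times> 'z) set \<Rightarrow> ('y \<Rightarrow> 'z) \<Rightarrow> 'y \<Rightarrow> 'y set)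
     \<Rightarrow> ('x \<Rightarrow> 'y \<Rightarrow> 'z) \<Rightarrow> 'x \<Rightarrow> ('z \<times> 'z) set \<Rightarrow> ('y, 'z) nbhd set" where
  "bar_map Y N gs x U = {nbhd N U (gs x) y | y. y \<in> topspace Y}"

definition upper_semi_continuous ::
  "'x topology \<Rightarrow> 'w topology \<Rightarrow> ('x \<Rightarrow> 'w set) \<Rightarrow> bool" where
  "upper_semi_continuous X W F \<longleftrightarrow>
     (\<forall>x\<in>topspace X. \<forall>V. openin W V \<and> F x \<subseteq> V \<longrightarrow>
        (\<exists>G. openin X G \<and> x \<in> G \<and> (\<forall>x'\<in>G. F x' \<subseteq> V)))"

definition usc_first_variable ::
  "'x topology \<Rightarrow> 'w topology \<Rightarrow> ('x \<Rightarrow> ('z::uniform_space \<times> 'z) set \<Rightarrow> 'w set) \<Rightarrow> bool" where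
  "usc_first_variable X W M \<longleftrightarrow> (\<forall>U\<in>entourages. upper_semi_continuous X W (\<lambda>x. M x U))"

definition admissible_EC :: "'y topology \<Rightarrow> ('y \<Rightarrow> 'z::uniform_space) topology \<Rightarrow> bool" where
  "admissible_EC Y T \<longleftrightarrow> equi_continuous (prod_topology T Y) (\<lambda>(f, y). f y)"

text \<open>
  The test spaces \<open>X\<close> range over all topological spaces whose points lie in the type \<open>'x\<close>; the
  first argument only names that type, since HOL has no quantifier over types.
  To express \<open>for each topological space\<close>, it is to be used with the type \<open>('y \<Rightarrow> 'z) + 'x\<close> for an
  arbitrary type variable \<open>'x\<close>: this universe has room for \<open>EC Y\<close> and for a homeomorphic copy of
  every space with points in \<open>'x\<close>.
\<close>

definition admissible_nbhd ::
  "'x itself \<Rightarrow> 'y topology \<Rightarrow> (('z \<times> 'z) set \<Rightarrow> ('y \<Rightarrow> 'z::uniform_space) \<Rightarrow> 'y \<Rightarrow> 'y set)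
     \<Rightarrow> ('y, 'z) nbhd topology \<Rightarrow> bool" where
  "admissible_nbhd _ Y N TT \<longleftrightarrow>
     (\<forall>(X :: 'x topology) gs g.
        gs ` topspace X \<subseteq> EC Y \<and> associated X Y g gs \<and>
        usc_first_variable X TT (bar_map Y N gs)
        \<longrightarrow> equi_continuous (prod_topology X Y) g)"

end

theory Submission
  imports Defs
begin

text \<open>
  Because members of the family remember their indices, a neighbourhood of a single \<open>U(f,y)\<close> in the
  dual topology contains some \<open>(H,U)\<close> with \<open>f \<in> H\<close> open, hence all of \<open>U(f',y')\<close> for \<open>f' \<in> H\<close>.
  So a map \<open>gs\<close> into the function space is continuous iff its bar map is upper semi continuous in the
  first variable (unless \<open>Y\<close> is empty). Admissibility of the dual topology is thus joint continuity
  of evaluation composed with continuous maps, and the identity of the function space is the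
  universal such map.
\<close>

text \<open>Open rectangles form a base of the product topology. With the factors separated,
  \<open>G\<close> can later be carried along a map between the left-hand spaces while
  \<open>W\<close> is kept.\<close>

lemma equi_continuous_prod_iff:
  "equi_continuous (prod_topology X Y) g \<longleftrightarrow>
     (\<forall>x\<in>topspace X. \<forall>y\<in>topspace Y. \<forall>U\<in>entourages.
        \<exists>G W. openin X G \<and> x \<in> G \<and> openin Y W \<and> y \<in> W \<and>
              (\<forall>x'\<in>G. \<forall>y'\<in>W. (g (x, y), g (x', y')) \<in> U))"
proof -
  have "(\<exists>V. openin (prod_topology X Y) V \<and> (x, y) \<in> V \<and> g ` V \<subseteq> U `` {g (x, y)}) \<longleftrightarrow>
        (\<exists>G W. openin X G \<and> x \<in> G \<and> openin Y W \<and> y \<in> W \<and>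
              (\<forall>x'\<in>G. \<forall>y'\<in>W. (g (x, y), g (x', y')) \<in> U))" (is "?L \<longleftrightarrow> ?R") for x y U
  proof
    assume ?L
    then obtain V where V: "openin (prod_topology X Y) V" "(x, y) \<in> V" "g ` V \<subseteq> U `` {g (x, y)}"
      by blast
    then obtain G W where "openin X G" "openin Y W" "x \<in> G" "y \<in> W" "G \<times> W \<subseteq> V"
      unfolding openin_prod_topology_alt by meson
    moreover from this V(3) have "(g (x, y), g (x', y')) \<in> U" if "x' \<in> G" "y' \<in> W" for x' y'
      using that by auto
    ultimately show ?R by (intro exI[of _ G] exI[of _ W]) simp
  next
    assume ?R
    then obtain G W where GW: "openin X G" "x \<in> G" "openin Y W" "y \<in> W"
      "\<forall>x'\<in>G. \<forall>y'\<in>W. (g (x, y), g (x', y')) \<in> U"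
      by blast
    then have "openin (prod_topology X Y) (G \<times> W)"
      by (simp add: openin_prod_Times_iff)
    with GW show ?L
      by (intro exI[of _ "G \<times> W"]) auto
  qed
  then show ?thesis
    unfolding equi_continuous_def equi_continuous_at_def topspace_prod_topology by simp
qed

lemma nbhd_in_dual_set_iff:
  "nbhd N U f y \<in> dual_set Y N H U' \<longleftrightarrow> U = U' \<and> f \<in> H \<and> y \<in> topspace Y"
  by (auto simp: dual_set_def nbhd_def)

lemma openin_dual_set:
  assumes "openin T H" "U \<in> entourages"
  shows "openin (dual_topology Y N T) (dual_set Y N H U)"
  unfolding dual_topology_def by (rule topology_generated_by_Basis) (use assms in blast)

lemma dual_set_Int: "dual_set Y N (H \<inter> H') U = dual_set Y N H U \<inter> dual_set Y N H' U"
  by (auto simp: dual_set_def nbhd_def)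

text \<open>Induction on the generation of \<open>V\<close>. A subbasic set containing the member
  with index \<open>(U, f, y)\<close> is a \<open>dual_set\<close> for this same \<open>U\<close>
  with \<open>f\<close> in its \<open>H\<close>, and dual sets with a common \<open>U\<close> are
  closed under intersection by \<open>dual_set_Int\<close>. The point \<open>y\<close> leaves no
  trace in \<open>H\<close>.\<close>

lemma openin_dual_topology_imp_dual_set:
  assumes "openin (dual_topology Y N T) V" "nbhd N U f y \<in> V"
  obtains H where "openin T H" "f \<in> H" "dual_set Y N H U \<subseteq> V"
proof -
  let ?B = "{dual_set Y N H U | H U. openin T H \<and> U \<in> entourages}"
  have "generate_topology_on ?B V"
    using assms(1) by (simp add: dual_topology_def openin_topology_generated_by_iff)
  then have "\<exists>H. openin T H \<and> f \<in> H \<and> dual_set Y N H U \<subseteq> V"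
    using assms(2)
  proof (induction rule: generate_topology_on.induct)
    case Empty
    then show ?case by simp
  next
    case (Int a b)
    then obtain H H' where "openin T H" "f \<in> H" "dual_set Y N H U \<subseteq> a"
      "openin T H'" "f \<in> H'" "dual_set Y N H' U \<subseteq> b"
      by blast
    then show ?case
      by (intro exI[of _ "H \<inter> H'"]) (auto simp: dual_set_Int)
  next
    case (UN K)
    from UN.prems obtain k where k: "k \<in> K" "nbhd N U f y \<in> k" by blast
    with UN.IH[OF k] show ?case by (meson Union_upper order_trans)
  next
    case (Basis s)
    then obtain H U' where H: "openin T H" "s = dual_set Y N H U'"
      by blast
    with Basis.prems have "U = U'" "f \<in> H"
      by (simp_all add: nbhd_in_dual_set_iff)
    with H show ?case by blast
  qed
  then show thesis using that by blast
qed

lemma usc_bar_map_if_continuous_map: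
  assumes "continuous_map X T gs"
  shows "usc_first_variable X (dual_topology Y N T) (bar_map Y N gs)"
  unfolding usc_first_variable_def upper_semi_continuous_def
proof (intro ballI allI impI)
  fix U x V
  assume x: "x \<in> topspace X" and V: "openin (dual_topology Y N T) V \<and> bar_map Y N gs x U \<subseteq> V"
  show "\<exists>G. openin X G \<and> x \<in> G \<and> (\<forall>x'\<in>G. bar_map Y N gs x' U \<subseteq> V)"
  proof (cases "topspace Y = {}")
    case True
    \<comment> \<open>Here all values of the bar map are empty.\<close>
    with x show ?thesis by (auto simp: bar_map_def)
  next
    case False
    \<comment> \<open>A single \<open>y\<close> suffices: the \<open>H\<close> found for it gives a
      \<open>dual_set\<close> inside \<open>V\<close> that contains the members for all points of
      \<open>Y\<close>.\<close>
    then obtain y where "y \<in> topspace Y" by blast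
    then have "nbhd N U (gs x) y \<in> V" using V by (auto simp: bar_map_def)
    then obtain H where H: "openin T H" "gs x \<in> H" "dual_set Y N H U \<subseteq> V"
      using V by (meson openin_dual_topology_imp_dual_set)
    have "openin X {x \<in> topspace X. gs x \<in> H}"
      using assms H(1) by (rule openin_continuous_map_preimage)
    moreover have "bar_map Y N gs x' U \<subseteq> V" if "gs x' \<in> H" for x'
      using that H(3) by (auto simp: bar_map_def dual_set_def)
    ultimately show ?thesis
      using x H(2) by (intro exI[of _ "{x \<in> topspace X. gs x \<in> H}"]) auto
  qed
qed

lemma continuous_map_if_usc_bar_map:
  fixes gs :: "'x \<Rightarrow> 'y \<Rightarrow> 'z::uniform_space"
  assumes gs: "gs ` topspace X \<subseteq> topspace T" and ne: "topspace Y \<noteq> {}"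
    and usc: "usc_first_variable X (dual_topology Y N T) (bar_map Y N gs)"
  shows "continuous_map X T gs"
  unfolding continuous_map_def
proof (intro conjI allI impI)
  show "gs \<in> topspace X \<rightarrow> topspace T" using gs by auto
next
  fix H assume H: "openin T H"
  \<comment> \<open>Semi continuity at one entourage already determines the preimage of
    \<open>H\<close>, and \<open>UNIV\<close> is an entourage of every uniformity.\<close>
  have U: "(UNIV :: ('z \<times> 'z) set) \<in> entourages" by (simp add: entourages_def)
  show "openin X {x \<in> topspace X. gs x \<in> H}"
  proof (subst openin_subopen, intro ballI)
    fix x assume "x \<in> {x \<in> topspace X. gs x \<in> H}"
    then have x: "x \<in> topspace X" and "bar_map Y N gs x UNIV \<subseteq> dual_set Y N H UNIV"
      by (auto simp: bar_map_def dual_set_def)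
    have "upper_semi_continuous X (dual_topology Y N T) (\<lambda>x. bar_map Y N gs x UNIV)"
      using usc U by (simp add: usc_first_variable_def)
    then obtain G where G: "openin X G" "x \<in> G"
      "\<forall>x'\<in>G. bar_map Y N gs x' UNIV \<subseteq> dual_set Y N H UNIV"
      unfolding upper_semi_continuous_def
      using x \<open>bar_map Y N gs x UNIV \<subseteq> _\<close> openin_dual_set[OF H U, of Y N] by meson
    \<comment> \<open>A member of the value at \<open>x'\<close> is needed to read off
      \<open>gs x'\<close> from its index; over an empty \<open>Y\<close> the inclusion in
      \<open>G(3)\<close> would say nothing.\<close>
    from ne obtain y where "y \<in> topspace Y" by blast
    then have "nbhd N UNIV (gs x') y \<in> bar_map Y N gs x' UNIV" for x'
      unfolding bar_map_def by blast
    with G(3) have "gs x' \<in> H" if "x' \<in> G" for x'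
      using that nbhd_in_dual_set_iff by (metis subsetD)
    with G show "\<exists>G. openin X G \<and> x \<in> G \<and> G \<subseteq> {x \<in> topspace X. gs x \<in> H}"
      using openin_subset[OF G(1)] by (intro exI[of _ G]) auto
  qed
qed

theorem theorem5p12:
  fixes Y :: "'y topology"
    and N :: "('z::uniform_space \<times> 'z) set \<Rightarrow> ('y \<Rightarrow> 'z) \<Rightarrow> 'y \<Rightarrow> 'y set"
    and T :: "('y \<Rightarrow> 'z) topology"
  assumes "nbhd_choice Y N"
    and "topspace T = EC Y"
  shows "admissible_EC Y T \<longleftrightarrow>
         admissible_nbhd TYPE(('y \<Rightarrow> 'z) + 'x) Y N (dual_topology Y N T)"
proof
  assume adm: "admissible_EC Y T"
  show "admissible_nbhd TYPE(('y \<Rightarrow> 'z) + 'x) Y N (dual_topology Y N T)"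
    unfolding admissible_nbhd_def equi_continuous_prod_iff
  proof (intro allI impI ballI, elim conjE)
    fix X :: "(('y \<Rightarrow> 'z) + 'x) topology" and gs g x y and U :: "('z \<times> 'z) set"
    assume gs: "gs ` topspace X \<subseteq> EC Y" and assoc: "associated X Y g gs"
      and usc: "usc_first_variable X (dual_topology Y N T) (bar_map Y N gs)"
      and x: "x \<in> topspace X" and y: "y \<in> topspace Y" and U: "U \<in> entourages"
    \<comment> \<open>The point \<open>y\<close> shows that \<open>Y\<close> is non-empty; otherwise
      the goal is vacuous.\<close>
    have cont: "continuous_map X T gs"
      using gs y usc assms(2) by (intro continuous_map_if_usc_bar_map) auto
    have "gs x \<in> topspace T" using gs x assms(2) by auto
    \<comment> \<open>Equi-continuity of evaluation at \<open>(gs x, y)\<close>; the factor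
      \<open>H\<close> is then pulled back along \<open>gs\<close>.\<close>
    with adm y U obtain H W where HW: "openin T H" "gs x \<in> H" "openin Y W" "y \<in> W"
      "\<forall>f\<in>H. \<forall>y'\<in>W. (gs x y, f y') \<in> U"
      unfolding admissible_EC_def equi_continuous_prod_iff prod.case by meson
    let ?G = "{x \<in> topspace X. gs x \<in> H}"
    have "openin X ?G"
      using cont HW(1) by (rule openin_continuous_map_preimage)
    moreover have "(g (x, y), g (x', y')) \<in> U" if "x' \<in> ?G" "y' \<in> W" for x' y'
    proof -
      have "y' \<in> topspace Y" using HW(3) that(2) openin_subset by blast
      then have "g (x, y) = gs x y" "g (x', y') = gs x' y'"
        using that x y assoc by (simp_all add: associated_def)
      with that HW(5) show ?thesis by simp
    qed
    ultimately show "\<exists>G W. openin X G \<and> x \<in> G \<and> openin Y W \<and> y \<in> W \<and>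
        (\<forall>x'\<in>G. \<forall>y'\<in>W. (g (x, y), g (x', y')) \<in> U)"
      using HW x by blast
  qed
next
  assume adm: "admissible_nbhd TYPE(('y \<Rightarrow> 'z) + 'x) Y N (dual_topology Y N T)"
  \<comment> \<open>a homeomorphic copy of \<open>T\<close> in the sum type\<close>
  define X :: "(('y \<Rightarrow> 'z) + 'x) topology" where "X = pullback_topology (range Inl) projl T"
  \<comment> \<open>On this copy \<open>projl\<close> acts as the identity of the function space,
    and the map associated with it is evaluation.\<close>
  define g :: "(('y \<Rightarrow> 'z) + 'x) \<times> 'y \<Rightarrow> 'z" where "g = (\<lambda>(x, y). projl x y)"
  have top: "topspace X = Inl ` topspace T"
    by (auto simp: X_def topspace_pullback_topology)
  have "continuous_map X T projl"
    using continuous_map_pullback[OF continuous_map_id, of "range Inl" projl T] by (simp add: X_def)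
  then have "usc_first_variable X (dual_topology Y N T) (bar_map Y N projl)"
    by (rule usc_bar_map_if_continuous_map)
  moreover have "projl ` topspace X \<subseteq> EC Y" "associated X Y g projl"
    by (auto simp: top associated_def g_def simp flip: assms(2))
  ultimately have ec: "equi_continuous (prod_topology X Y) g"
    using adm[unfolded admissible_nbhd_def, rule_format, of projl X g] by simp
  show "admissible_EC Y T"
    unfolding admissible_EC_def equi_continuous_prod_iff prod.case
  proof (intro ballI)
    fix f y and U :: "('z \<times> 'z) set"
    assume f: "f \<in> topspace T" and y: "y \<in> topspace Y" and U: "U \<in> entourages"
    from f have "Inl f \<in> topspace X" by (simp add: top)
    with ec y U obtain G W where GW: "openin X G" "Inl f \<in> G" "openin Y W" "y \<in> W"
      "\<forall>x'\<in>G. \<forall>y'\<in>W. (g (Inl f, y), g (x', y')) \<in> U"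
      unfolding equi_continuous_prod_iff by meson
    \<comment> \<open>Open sets of \<open>X\<close> are exactly the copies of open sets of
      \<open>T\<close>, so the neighbourhood found for \<open>g\<close> transfers back to
      evaluation.\<close>
    from GW(1) obtain H where H: "openin T H" "G = projl -` H \<inter> range Inl"
      by (auto simp: X_def openin_pullback_topology)
    have "(f y, f' y') \<in> U" if "f' \<in> H" "y' \<in> W" for f' y'
    proof -
      have "Inl f' \<in> G" using that(1) by (simp add: H(2))
      with GW(5) that(2) show ?thesis by (fastforce simp: g_def)
    qed
    with GW H show "\<exists>H W. openin T H \<and> f \<in> H \<and> openin Y W \<and> y \<in> W \<and>
        (\<forall>f'\<in>H. \<forall>y'\<in>W. (f y, f' y') \<in> U)"
      by (intro exI[of _ H] exI[of _ W]) auto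
  qed
qed

end
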